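(* Let $n\ge5$. For each $U\subseteq V(G_n)$, let $\pi(U)$ denote the collection of vertex sets of the connected components of the induced subgraph $G_n[U]$. Then the Hilbert series of $S_{G_n}/J_{G_n}$ is $$H_{S_{G_n}/J_{G_n}}(t)=\sum_{U\subseteq V(G_n)}\frac{t^{|U|}\prod_{C\in\pi(U)}(|C|+1-t)}{(1-t)^{|U|+|\pi(U)|}}.$$ Here $\pi(\varnothing)=\varnothing$, and the empty product is interpreted as $1$, so the empty-set summand is $1$.
   Context: Graph $G_n$: let $X=\{u_0,\dots,u_{n-1}\}$ and $Y=\{v_0,\dots,v_{n-1}\}$ be disjoint, indices modulo $n$. $G_n$ is the bipartite graph on $X\sqcup Y$ with $\{u_i,v_j\}\in E(G_n)$ iff $j\notin\{i,i-1\}$ modulo $n$ (the bipartite complement of the cycle $C_{2n}$ with edges $\{u_i,v_i\},\{u_i,v_{i-1}\}$). Binomial edge ideal: let $\mathbb K$ be an arbitrary field. For a finite simple graph $G$, $S_G=\mathbb K[x_w,y_w:w\in V(G)]$ (standard graded, all variables of degree 1) and $J_G\subseteq S_G$ is the ideal generated by $x_ay_b-x_by_a$ for all edges $\{a,b\}\in E(G)$. For a standard graded finitely generated $\mathbb K$-algebra $R=\bigoplus_{d\ge0}R_d$, its Hilbert series is $H_R(t)=\sum_{d\ge0}\dim_{\mathbb K}(R_d)t^d$. *)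

theory Defs
  imports
    "HOL-Algebra.Embedded_Algebras"
    "HOL-Algebra.QuotRing"
    "HOL-Library.Poly_Mapping"
    "HOL-Number_Theory.Cong"
    "HOL-Computational_Algebra.Formal_Power_Series"
begin

text \<open>
  A finite simple graph is given by a vertex set and a set of two-element edges.
  The vertex \<open>u\<^sub>i\<close> is \<open>Inl i\<close> and \<open>v\<^sub>j\<close> is \<open>Inr j\<close>, with representatives
  \<open>0, \<dots>, n - 1\<close> of the indices modulo \<open>n\<close>.
\<close>

definition G_verts :: "nat \<Rightarrow> (nat + nat) set" where
  "G_verts n = Inl ` {..<n} \<union> Inr ` {..<n}"

definition G_edges :: "nat \<Rightarrow> (nat + nat) set set" where
  "G_edges n = {{Inl i, Inr j} | i j. i < n \<and> j < n \<and>
     \<not> [int j = int i] (mod int n) \<and> \<not> [int j = int i - 1] (mod int n)}"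

definition induced_edges :: "'v set set \<Rightarrow> 'v set \<Rightarrow> 'v set set" where
  "induced_edges E U = {e \<in> E. e \<subseteq> U}"

text \<open>The vertex sets of the connected components are the classes of mutual reachability.\<close>

definition components :: "'v set \<Rightarrow> 'v set set \<Rightarrow> 'v set set" where
  "components V E = V // {(a, b). a \<in> V \<and> b \<in> V \<and> (a, b) \<in> {(c, d). {c, d} \<in> E}\<^sup>*}"

datatype 'v bvar = xvar 'v | yvar 'v

text \<open>
  Monomials are finitely supported exponent vectors, and polynomials are finitely supported
  families of coefficients indexed by monomials. The type has variables for all elements of
  \<open>'v\<close>; the ring \<open>S\<^sub>G\<close> is cut out by restricting the carrier to polynomials in
  the variables attached to the vertices in \<open>V\<close>.
\<close>

type_synonym ('v, 'k) bpoly = "('v bvar \<Rightarrow>\<^sub>0 nat) \<Rightarrow>\<^sub>0 'k"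

definition S_carrier :: "'v set \<Rightarrow> ('v, 'k::field) bpoly set" where
  "S_carrier V = {p. \<forall>m \<in> Poly_Mapping.keys p. Poly_Mapping.keys m \<subseteq> xvar ` V \<union> yvar ` V}"

definition S_ring :: "'v set \<Rightarrow> ('v, 'k::field) bpoly ring" where
  "S_ring V = \<lparr>carrier = S_carrier V, monoid.mult = (*), one = 1, zero = 0, add = (+)\<rparr>"

definition S_scalars :: "('v, 'k::field) bpoly set" where
  "S_scalars = {Poly_Mapping.single 0 c | c. True}"

definition monomial_degree :: "('x \<Rightarrow>\<^sub>0 nat) \<Rightarrow> nat" where
  "monomial_degree m = (\<Sum>z \<in> Poly_Mapping.keys m. Poly_Mapping.lookup m z)"

definition S_homogeneous :: "'v set \<Rightarrow> nat \<Rightarrow> ('v, 'k::field) bpoly set" where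
  "S_homogeneous V d =
     {p \<in> S_carrier V. \<forall>m \<in> Poly_Mapping.keys p. monomial_degree m = d}"

definition xpoly :: "'v \<Rightarrow> ('v, 'k::field) bpoly" where
  "xpoly a = Poly_Mapping.single (Poly_Mapping.single (xvar a) 1) 1"

definition ypoly :: "'v \<Rightarrow> ('v, 'k::field) bpoly" where
  "ypoly a = Poly_Mapping.single (Poly_Mapping.single (yvar a) 1) 1"

text \<open>
  Each edge contributes its generator twice, once for each order of its endpoints; the two
  differ only by sign.
\<close>

definition binomial_edge_ideal :: "'v set \<Rightarrow> 'v set set \<Rightarrow> ('v, 'k::field) bpoly set" where
  "binomial_edge_ideal V E =
     genideal (S_ring V) {xpoly a * ypoly b - xpoly b * ypoly a | a b. {a, b} \<in> E}"

text \<open>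
  \<open>K\<close> is the copy of the ground field inside \<open>R\<close>, and \<open>A d\<close> is the homogeneous
  component of degree \<open>d\<close>, assumed to be finite-dimensional (\<open>ring.dim\<close> is otherwise
  unspecified).
\<close>

definition hilbert_series ::
    "('a, 'b) ring_scheme \<Rightarrow> 'a set \<Rightarrow> (nat \<Rightarrow> 'a set) \<Rightarrow> rat fps" where
  "hilbert_series R K A = Abs_fps (\<lambda>d. of_nat (ring.dim R K (A d)))"

text \<open>
  The Hilbert series of \<open>R / J\<close> with the grading (and scalars) inherited from \<open>R\<close>
  along the projection \<open>p \<mapsto> J + p\<close>.
\<close>

definition quotient_hilbert_series ::
    "('a, 'b) ring_scheme \<Rightarrow> 'a set \<Rightarrow> (nat \<Rightarrow> 'a set) \<Rightarrow> 'a set \<Rightarrow> rat fps" where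
  "quotient_hilbert_series R K A J =
     hilbert_series (R Quot J) (a_r_coset R J ` K) (\<lambda>d. a_r_coset R J ` A d)"

definition binomial_edge_hilbert_series ::
    "'k::field itself \<Rightarrow> 'v set \<Rightarrow> 'v set set \<Rightarrow> rat fps" where
  "binomial_edge_hilbert_series k V E =
     quotient_hilbert_series (S_ring V :: ('v, 'k) bpoly ring) S_scalars (S_homogeneous V)
       (binomial_edge_ideal V E)"

end

theory Submission
  imports Defs
begin

text \<open>
  Let $m$ be a monomial and let \<open>{a, b}\<close> be an edge. Since the generators of $J_G$ are differences of
  two monomials, $J_G$ is the linear span of the differences $m x_a y_b - m x_b y_a$
  (\<open>binomial_edge_ideal_eq_swap_ideal\<close>). Hence the quotient has a basis indexed by the classes of
  monomials under the swaps $m x_a y_b \leftrightarrow m x_b y_a$, and its Hilbert function at $d$ is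
  the number of classes in degree $d$ (\<open>dim_quotient_swap_ideal\<close>).

  The classes can be described completely. A swap preserves the number $a_v$ of variables at each vertex
  $v$, hence the support $U$ of the monomial, and also the number of $x$-variables on each connected
  component of $G[U]$. Nothing else is preserved (\<open>swaps_if_swap_type_eq\<close>): if two vertices are joined
  by a path inside $U$, then all inner vertices of the path carry a variable, and with the help of these an
  $x$ can be passed from one end of the path to the other in exchange for a $y$ (\<open>swap_along_path\<close>).

  So for a fixed multidegree $a$ with support $U$ there are $\prod_{C \in \pi(U)} (|a_C| + 1)$ classes,
  where $|a_C|$ is the sum of $a$ over $C$ and the factor counts the possible numbers of $x$-variables on
  $C$ (\<open>card_swap_types\<close>). Summing $t^{|a|}$ with these weights over all $a$ with support $U$ gives a
  product over the components (\<open>weight_series_disjoint_Union\<close>), and the factor of \<open>C\<close> is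
  $t^{|C|}(|C|+1-t)/(1-t)^{|C|+1}$ (\<open>weight_series_component\<close>).
\<close>

section \<open>Monomials and swaps along edges\<close>

definition xmon :: "'v \<Rightarrow> 'v bvar \<Rightarrow>\<^sub>0 nat" where
  "xmon a = Poly_Mapping.single (xvar a) 1"

definition ymon :: "'v \<Rightarrow> 'v bvar \<Rightarrow>\<^sub>0 nat" where
  "ymon a = Poly_Mapping.single (yvar a) 1"

definition monomials :: "'v set \<Rightarrow> ('v bvar \<Rightarrow>\<^sub>0 nat) set" where
  "monomials V = {m. Poly_Mapping.keys m \<subseteq> xvar ` V \<union> yvar ` V}"

definition monomials_of_degree :: "'v set \<Rightarrow> nat \<Rightarrow> ('v bvar \<Rightarrow>\<^sub>0 nat) set" where
  "monomials_of_degree V d = {m \<in> monomials V. monomial_degree m = d}"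

definition xdeg :: "('v bvar \<Rightarrow>\<^sub>0 nat) \<Rightarrow> 'v \<Rightarrow> nat" where
  "xdeg m v = Poly_Mapping.lookup m (xvar v)"

definition ydeg :: "('v bvar \<Rightarrow>\<^sub>0 nat) \<Rightarrow> 'v \<Rightarrow> nat" where
  "ydeg m v = Poly_Mapping.lookup m (yvar v)"

definition vdeg :: "('v bvar \<Rightarrow>\<^sub>0 nat) \<Rightarrow> 'v \<Rightarrow> nat" where
  "vdeg m v = xdeg m v + ydeg m v"

definition supp :: "('v bvar \<Rightarrow>\<^sub>0 nat) \<Rightarrow> 'v set" where
  "supp m = {v. vdeg m v \<noteq> 0}"

text \<open>
  The monomials $m x_a y_b$ and $m x_b y_a$ related by a swap are the two terms of a monomial multiple
  of a generator of $J_G$, so that membership in $J_G$ becomes a question about chains of swaps.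
\<close>
inductive swap :: "'v set set \<Rightarrow> ('v bvar \<Rightarrow>\<^sub>0 nat) \<Rightarrow> ('v bvar \<Rightarrow>\<^sub>0 nat) \<Rightarrow> bool"
  for E where
  swapI: "{a, b} \<in> E \<Longrightarrow> swap E (m + xmon a + ymon b) (m + xmon b + ymon a)"

lemma xdeg_simps [simp]:
  "xdeg (m + m') v = xdeg m v + xdeg m' v"
  "xdeg (xmon a) v = (if v = a then 1 else 0)" "xdeg (ymon a) v = 0"
  by (auto simp: xdeg_def xmon_def ymon_def lookup_add lookup_single when_def)

lemma ydeg_simps [simp]:
  "ydeg (m + m') v = ydeg m v + ydeg m' v"
  "ydeg (ymon a) v = (if v = a then 1 else 0)" "ydeg (xmon a) v = 0"
  by (auto simp: ydeg_def xmon_def ymon_def lookup_add lookup_single when_def)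

lemma vdeg_simps [simp]:
  "vdeg (m + m') v = vdeg m v + vdeg m' v"
  "vdeg (xmon a) v = (if v = a then 1 else 0)" "vdeg (ymon a) v = (if v = a then 1 else 0)"
  by (auto simp: vdeg_def)

lemma monomial_eqI:
  assumes "\<And>v. xdeg m v = xdeg m' v" "\<And>v. ydeg m v = ydeg m' v"
  shows "m = m'"
proof (rule poly_mapping_eqI)
  fix z show "Poly_Mapping.lookup m z = Poly_Mapping.lookup m' z"
    using assms by (cases z) (auto simp: xdeg_def ydeg_def)
qed

lemma monomials_iff_supp: "m \<in> monomials V \<longleftrightarrow> supp m \<subseteq> V"
proof
  assume m: "m \<in> monomials V"
  show "supp m \<subseteq> V"
  proof
    fix v assume "v \<in> supp m"
    then have "xvar v \<in> Poly_Mapping.keys m \<or> yvar v \<in> Poly_Mapping.keys m"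
      by (auto simp: supp_def vdeg_def xdeg_def ydeg_def in_keys_iff)
    with m show "v \<in> V" by (auto simp: monomials_def)
  qed
next
  assume s: "supp m \<subseteq> V"
  show "m \<in> monomials V" unfolding monomials_def
  proof (intro CollectI subsetI)
    fix z assume z: "z \<in> Poly_Mapping.keys m"
    show "z \<in> xvar ` V \<union> yvar ` V"
    proof (cases z)
      case (xvar v)
      with z have "v \<in> supp m" by (auto simp: supp_def vdeg_def xdeg_def in_keys_iff)
      with s xvar show ?thesis by auto
    next
      case (yvar v)
      with z have "v \<in> supp m" by (auto simp: supp_def vdeg_def ydeg_def in_keys_iff)
      with s yvar show ?thesis by auto
    qed
  qed
qed

lemma supp_add: "supp (m + m') = supp m \<union> supp m'"
  by (auto simp: supp_def)

lemma supp_single [simp]: "supp (xmon a) = {a}" "supp (ymon a) = {a}"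
  by (auto simp: supp_def split: if_splits)

lemma monomials_add: "m \<in> monomials V \<Longrightarrow> m' \<in> monomials V \<Longrightarrow> m + m' \<in> monomials V"
  by (simp add: monomials_iff_supp supp_add)

lemma monomial_degree_eq_sum_vdeg:
  assumes "finite V" "m \<in> monomials V"
  shows "monomial_degree m = (\<Sum>v\<in>V. vdeg m v)"
proof -
  have "monomial_degree m = (\<Sum>z \<in> xvar ` V \<union> yvar ` V. Poly_Mapping.lookup m z)"
    unfolding monomial_degree_def using assms
    by (intro sum.mono_neutral_left) (auto simp: monomials_def in_keys_iff)
  also have "\<dots> = (\<Sum>z \<in> xvar ` V. Poly_Mapping.lookup m z) + (\<Sum>z \<in> yvar ` V. Poly_Mapping.lookup m z)"
    using assms by (intro sum.union_disjoint) auto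
  also have "\<dots> = (\<Sum>v\<in>V. xdeg m v) + (\<Sum>v\<in>V. ydeg m v)"
    by (simp add: sum.reindex inj_on_def xdeg_def ydeg_def)
  finally show ?thesis by (simp add: vdeg_def sum.distrib)
qed

lemma finite_monomials_of_degree:
  assumes "finite V"
  shows "finite (monomials_of_degree V d)"
proof (rule finite_imageD)
  let ?W = "xvar ` V \<union> yvar ` V"
  let ?f = "\<lambda>m. restrict (Poly_Mapping.lookup m) ?W"
  have "?f m \<in> ?W \<rightarrow>\<^sub>E {..d}" if "m \<in> monomials_of_degree V d" for m
  proof -
    have le: "Poly_Mapping.lookup m z \<le> d" for z
    proof (cases "z \<in> Poly_Mapping.keys m")
      case True
      then have "Poly_Mapping.lookup m z \<le> monomial_degree m"
        unfolding monomial_degree_def by (intro member_le_sum) auto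
      with that show ?thesis by (simp add: monomials_of_degree_def)
    next
      case False
      then show ?thesis by (simp add: in_keys_iff)
    qed
    then show ?thesis unfolding restrict_PiE_iff by blast
  qed
  then show "finite (?f ` monomials_of_degree V d)"
    using assms by (intro finite_subset[OF _ finite_PiE[of ?W "\<lambda>_. {..d}"]]) blast+
  show "inj_on ?f (monomials_of_degree V d)"
  proof (rule inj_onI, rule poly_mapping_eqI)
    fix m m' z
    assume m: "m \<in> monomials_of_degree V d" "m' \<in> monomials_of_degree V d" and eq: "?f m = ?f m'"
    show "Poly_Mapping.lookup m z = Poly_Mapping.lookup m' z"
    proof (cases "z \<in> ?W")
      case True
      then show ?thesis using fun_cong[OF eq, of z] by simp
    next
      case False
      then have "z \<notin> Poly_Mapping.keys m" "z \<notin> Poly_Mapping.keys m'"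
        using m by (auto simp: monomials_of_degree_def monomials_def)
      then show ?thesis by (simp add: in_keys_iff)
    qed
  qed
qed

lemma swap_add_left: "swap E m m' \<Longrightarrow> swap E (l + m) (l + m')"
proof (induction rule: swap.induct)
  case (swapI a b m)
  from swap.swapI[OF this, of "l + m"] show ?case by (simp only: add.assoc)
qed

lemma vdeg_swap: "swap E m m' \<Longrightarrow> vdeg m' = vdeg m"
  by (induction rule: swap.induct) (auto simp: fun_eq_iff)

lemma supp_swap: "swap E m m' \<Longrightarrow> supp m' = supp m"
  by (simp add: supp_def vdeg_swap)

lemma monomials_of_degree_swap:
  assumes "finite V" "swap E m m'"
  shows "m' \<in> monomials_of_degree V d \<longleftrightarrow> m \<in> monomials_of_degree V d"
proof -
  have iff: "m' \<in> monomials V \<longleftrightarrow> m \<in> monomials V"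
    by (simp add: monomials_iff_supp supp_swap[OF assms(2)])
  have "monomial_degree m' = monomial_degree m" if "m \<in> monomials V"
    using that iff by (simp add: monomial_degree_eq_sum_vdeg[OF assms(1)] vdeg_swap[OF assms(2)])
  with iff show ?thesis by (auto simp: monomials_of_degree_def)
qed

lemma xmon_factor: "xdeg m v \<noteq> 0 \<Longrightarrow> \<exists>m'. m = m' + xmon v"
proof -
  assume "xdeg m v \<noteq> 0"
  then have "m = (m - xmon v) + xmon v"
    by (intro poly_mapping_eqI)
      (auto simp: lookup_add lookup_minus lookup_single when_def xdeg_def xmon_def)
  then show ?thesis by blast
qed

lemma ymon_factor: "ydeg m v \<noteq> 0 \<Longrightarrow> \<exists>m'. m = m' + ymon v"
proof -
  assume "ydeg m v \<noteq> 0"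
  then have "m = (m - ymon v) + ymon v"
    by (intro poly_mapping_eqI)
      (auto simp: lookup_add lookup_minus lookup_single when_def ydeg_def ymon_def)
  then show ?thesis by blast
qed

section \<open>Swap classes\<close>

definition linked :: "'v set \<Rightarrow> 'v set set \<Rightarrow> ('v \<times> 'v) set" where
  "linked U E = {(a, b). a \<in> U \<and> b \<in> U \<and> (a, b) \<in> {(c, d). {c, d} \<in> induced_edges E U}\<^sup>*}"

abbreviation comps :: "'v set set \<Rightarrow> 'v set \<Rightarrow> 'v set set" where
  "comps E U \<equiv> components U (induced_edges E U)"

lemma components_eq_quotient: "comps E U = U // linked U E"
  by (simp add: components_def linked_def)

lemma equiv_linked: "equiv U (linked U E)"
proof (rule equivI)
  have "sym ({(c, d). {c, d} \<in> induced_edges E U}\<^sup>*)"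
    by (intro sym_rtrancl symI) (auto simp: insert_commute)
  then show "sym (linked U E)" by (auto simp: linked_def sym_def)
qed (auto simp: linked_def refl_on_def trans_def)

lemma Union_comps: "\<Union> (comps E U) = U"
  unfolding components_eq_quotient by (rule Union_quotient[OF equiv_linked])

lemma comps_disjoint: "C \<in> comps E U \<Longrightarrow> D \<in> comps E U \<Longrightarrow> C \<noteq> D \<Longrightarrow> C \<inter> D = {}"
  unfolding components_eq_quotient using quotient_disj[OF equiv_linked] by blast

lemma comps_subset: "C \<in> comps E U \<Longrightarrow> C \<subseteq> U"
  using Union_comps[of U E] by blast

lemma finite_comps: "finite U \<Longrightarrow> finite (comps E U)"
  using Union_comps[of U E] by (metis finite_UnionD)

lemma linked_in_comp:
  assumes "C \<in> comps E U" "a \<in> C" "b \<in> C"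
  shows "(a, b) \<in> linked U E"
  using assms unfolding components_eq_quotient
  by (intro in_quotient_imp_in_rel[OF equiv_linked]) auto

lemma comp_closed_edge:
  assumes "C \<in> comps E U" "{a, b} \<in> E" "a \<in> U" "b \<in> U"
  shows "a \<in> C \<longleftrightarrow> b \<in> C"
proof -
  have ab: "(a, b) \<in> linked U E"
    using assms by (auto simp: linked_def induced_edges_def)
  then have ba: "(b, a) \<in> linked U E"
    using equiv_linked[of U E] by (meson equivE symD)
  note closed = in_quotient_imp_closed[OF equiv_linked assms(1)[unfolded components_eq_quotient]]
  show ?thesis using closed[OF _ ab] closed[OF _ ba] by blast
qed

text \<open>
  The algebraic form is $x_c (x_a y_b - x_b y_a) = x_b (x_a y_c - x_c y_a) + x_a (x_c y_b - x_b y_c)$,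
  and likewise with $y_c$ in front: in the presence of a variable of each inner vertex of a path, its
  endpoints can be treated as adjacent. For the first edge from \<open>a\<close> to \<open>c\<close> there are two orders. If
  \<open>c\<close> carries a \<open>y\<close>, the \<open>x\<close> of \<open>a\<close> moves to \<open>c\<close> at once and then on to \<open>b\<close>; if \<open>c\<close> carries an
  \<open>x\<close>, that one is first sent on to \<open>b\<close>, and the \<open>x\<close> of \<open>a\<close> then takes its place.
\<close>
lemma swap_along_path:
  assumes "(a, b) \<in> {(c, d). {c, d} \<in> induced_edges E U}\<^sup>*"
    and "U \<subseteq> supp (m + xmon a + ymon b)"
  shows "(swap E)\<^sup>*\<^sup>* (m + xmon a + ymon b) (m + xmon b + ymon a)"
  using assms
proof (induction arbitrary: m rule: converse_rtrancl_induct)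
  case base
  then show ?case by simp
next
  case (step a c)
  then have E: "{a, c} \<in> E" and c: "c \<in> U" by (auto simp: induced_edges_def)
  consider "c = b" | "c = a" | "c \<noteq> a" "c \<noteq> b" by blast
  then show ?case
  proof cases
    case 1
    with E show ?thesis by (simp add: swapI r_into_rtranclp)
  next
    case 2
    with step show ?thesis by blast
  next
    case 3
    with c step.prems have "c \<in> supp m" by (auto simp: supp_add)
    then have "xdeg m c \<noteq> 0 \<or> ydeg m c \<noteq> 0" by (auto simp: supp_def vdeg_def)
    then show ?thesis
    proof
      assume "ydeg m c \<noteq> 0"
      from ymon_factor[OF this] obtain l where m: "m = l + ymon c" ..
      have "swap E (m + xmon a + ymon b) ((l + ymon a) + xmon c + ymon b)"
        using swapI[OF E, of "l + ymon b"] by (simp add: m ac_simps)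
      also have "(swap E)\<^sup>*\<^sup>* \<dots> ((l + ymon a) + xmon b + ymon c)"
        using step.prems by (intro step.IH) (auto simp: m supp_add)
      also have "(l + ymon a) + xmon b + ymon c = m + xmon b + ymon a"
        by (simp add: m ac_simps)
      finally show ?thesis .
    next
      assume "xdeg m c \<noteq> 0"
      from xmon_factor[OF this] obtain l where m: "m = l + xmon c" ..
      have "m + xmon a + ymon b = (l + xmon a) + xmon c + ymon b"
        by (simp add: m ac_simps)
      also have "(swap E)\<^sup>*\<^sup>* \<dots> ((l + xmon a) + xmon b + ymon c)"
        using step.prems by (intro step.IH) (auto simp: m supp_add)
      also have "swap E \<dots> (m + xmon b + ymon a)"
        using swapI[OF E, of "l + xmon b"] by (simp add: m ac_simps)
      finally show ?thesis .
    qed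
  qed
qed

text \<open>
  The invariants of a swap: it keeps the number of variables at each vertex, hence the support, and it
  moves an \<open>x\<close> only between adjacent vertices of the support, hence inside one component. The two
  functions are cut off outside their finite domains, so that the swap types of a given degree form a
  dependent product of finite sets.
\<close>
definition swap_type :: "'v set set \<Rightarrow> ('v bvar \<Rightarrow>\<^sub>0 nat) \<Rightarrow> 'v set \<times> ('v \<Rightarrow> nat) \<times> ('v set \<Rightarrow> nat)" where
  "swap_type E m =
     (supp m, restrict (vdeg m) (supp m), restrict (\<lambda>C. \<Sum>v\<in>C. xdeg m v) (comps E (supp m)))"

lemma finite_supp [simp]: "finite (supp m)"
proof (rule finite_subset)
  show "supp m \<subseteq> xvar -` Poly_Mapping.keys m \<union> yvar -` Poly_Mapping.keys m"
    by (auto simp: supp_def vdeg_def xdeg_def ydeg_def in_keys_iff)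
  show "finite (xvar -` Poly_Mapping.keys m \<union> yvar -` Poly_Mapping.keys m)"
    by (auto intro!: finite_vimageI simp: inj_on_def)
qed

lemma swap_type_swap:
  assumes "swap E m m'"
  shows "swap_type E m' = swap_type E m"
proof -
  have "(\<Sum>v\<in>C. xdeg m' v) = (\<Sum>v\<in>C. xdeg m v)" if C: "C \<in> comps E (supp m)" for C
    using assms
  proof cases
    case (swapI a b l)
    have "finite C" using comps_subset[OF C] finite_supp finite_subset by blast
    moreover have "a \<in> C \<longleftrightarrow> b \<in> C"
      using swapI by (intro comp_closed_edge[OF C]) (auto simp: supp_add)
    ultimately show ?thesis using swapI by (simp add: sum.distrib)
  qed
  then show ?thesis
    by (auto simp: swap_type_def supp_swap[OF assms] vdeg_swap[OF assms])
qed

text \<open>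
  Conversely the swap type is a complete invariant. If the \<open>x\<close>-degrees of \<open>m\<close> and \<open>m'\<close> differ, then,
  the totals over each component being equal, some component has a vertex with too many \<open>x\<close> and one with
  too few (hence one \<open>y\<close> to spare). The two are connected within the support, so an \<open>x\<close> can be passed
  from the first to the second, which decreases the total excess of \<open>x\<close>.
\<close>
lemma swaps_if_swap_type_eq:
  assumes "swap_type E m = swap_type E m'"
  shows "(swap E)\<^sup>*\<^sup>* m m'"
  using assms
proof (induction "\<Sum>v\<in>supp m. xdeg m v - xdeg m' v" arbitrary: m rule: less_induct)
  case less
  let ?U = "supp m"
  have U: "supp m' = ?U" using less.prems by (simp add: swap_type_def)
  have out: "vdeg m v = 0" "vdeg m' v = 0" if "v \<notin> ?U" for v
    using that U unfolding supp_def by blast+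
  have vd: "vdeg m v = vdeg m' v" for v
  proof (cases "v \<in> ?U")
    case True
    have "restrict (vdeg m) ?U = restrict (vdeg m') ?U"
      using less.prems U by (simp add: swap_type_def)
    from fun_cong[OF this, of v] True show ?thesis by simp
  qed (simp add: out)
  have xs: "(\<Sum>v\<in>C. xdeg m v) = (\<Sum>v\<in>C. xdeg m' v)" if "C \<in> comps E ?U" for C
  proof -
    have "restrict (\<lambda>C. \<Sum>v\<in>C. xdeg m v) (comps E ?U) = restrict (\<lambda>C. \<Sum>v\<in>C. xdeg m' v) (comps E ?U)"
      using less.prems U by (simp add: swap_type_def)
    from fun_cong[OF this, of C] that show ?thesis by simp
  qed
  show ?case
  proof (cases "\<forall>v. xdeg m v = xdeg m' v")
    case True
    have "ydeg m v = ydeg m' v" for v using vd[of v] True by (simp add: vdeg_def)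
    with True have "m = m'" by (intro monomial_eqI) auto
    then show ?thesis by simp
  next
    case False
    then obtain v0 where v0: "xdeg m v0 \<noteq> xdeg m' v0" by blast
    with out[of v0] have "v0 \<in> ?U" by (cases "v0 \<in> ?U") (auto simp: vdeg_def)
    then obtain C where C: "C \<in> comps E ?U" "v0 \<in> C" using Union_comps[of ?U E] by blast
    have finC: "finite C" using comps_subset[OF C(1)] finite_supp by (rule finite_subset)
    have "\<exists>v\<in>C. xdeg m v > xdeg m' v"
    proof (rule ccontr)
      assume "\<not> ?thesis"
      then have "\<And>v. v \<in> C \<Longrightarrow> xdeg m v \<le> xdeg m' v" by (auto simp: not_less)
      then have "(\<Sum>v\<in>C. xdeg m v) < (\<Sum>v\<in>C. xdeg m' v)"
        using v0 C finC by (intro sum_strict_mono_ex1) (auto simp: order.strict_iff_order)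
      with xs[OF C(1)] show False by simp
    qed
    then obtain a where a: "a \<in> C" "xdeg m a > xdeg m' a" by blast
    have "\<exists>v\<in>C. xdeg m v < xdeg m' v"
    proof (rule ccontr)
      assume "\<not> ?thesis"
      then have "\<And>v. v \<in> C \<Longrightarrow> xdeg m' v \<le> xdeg m v" by (auto simp: not_less)
      then have "(\<Sum>v\<in>C. xdeg m' v) < (\<Sum>v\<in>C. xdeg m v)"
        using a finC by (intro sum_strict_mono_ex1) auto
      with xs[OF C(1)] show False by simp
    qed
    then obtain b where b: "b \<in> C" "xdeg m b < xdeg m' b" by blast
    from a obtain l where l: "m = l + xmon a" using xmon_factor[of m a] by auto
    have "ydeg m b \<noteq> 0" using b(2) vd[of b] by (simp add: vdeg_def)
    then have "ydeg l b \<noteq> 0" by (simp add: l)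
    from ymon_factor[OF this] obtain l' where "l = l' + ymon b" ..
    with l have m: "m = l' + xmon a + ymon b" by (simp add: ac_simps)
    define m1 where "m1 = l' + xmon b + ymon a"
    have "(a, b) \<in> linked ?U E" using linked_in_comp[OF C(1) a(1) b(1)] .
    then have path: "(swap E)\<^sup>*\<^sup>* m m1"
      unfolding m m1_def by (intro swap_along_path) (auto simp: linked_def)
    have type: "swap_type E m1 = swap_type E m" using path
      by (induction rule: rtranclp_induct) (auto simp: swap_type_swap)
    have s: "supp m1 = ?U" by (auto simp: m1_def m supp_add)
    have ab: "a \<noteq> b" using a b by auto
    have "(\<Sum>v\<in>supp m1. xdeg m1 v - xdeg m' v) < (\<Sum>v\<in>?U. xdeg m v - xdeg m' v)"
      unfolding s
    proof (rule sum_strict_mono_ex1)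
      show "\<forall>v\<in>?U. xdeg m1 v - xdeg m' v \<le> xdeg m v - xdeg m' v"
        using a b ab by (auto simp: m m1_def split: if_splits)
      show "\<exists>v\<in>?U. xdeg m1 v - xdeg m' v < xdeg m v - xdeg m' v"
        using a b ab comps_subset[OF C(1)]
        by (intro bexI[of _ a]) (auto simp: m m1_def split: if_splits)
    qed simp
    then have "(swap E)\<^sup>*\<^sup>* m1 m'" using type less.prems by (intro less.hyps) auto
    with path show ?thesis by (rule rtranclp_trans)
  qed
qed

section \<open>The polynomial ring and its ideal of swap differences\<close>

lemma S_carrier_eq: "S_carrier V = {p. Poly_Mapping.keys p \<subseteq> monomials V}"
  by (auto simp: S_carrier_def monomials_def)

lemma S_ring_simps [simp]:
  "carrier (S_ring V) = S_carrier V" "monoid.mult (S_ring V) = (*)" "one (S_ring V) = 1"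
  "zero (S_ring V) = 0" "add (S_ring V) = (+)"
  by (simp_all add: S_ring_def)

lemma single_in_S_carrier: "m \<in> monomials V \<Longrightarrow> Poly_Mapping.single m c \<in> S_carrier V"
  by (simp add: S_carrier_eq)

lemma S_carrier_zero: "0 \<in> S_carrier V" and S_carrier_one: "1 \<in> S_carrier V"
  by (simp_all add: S_carrier_def)

lemma S_carrier_add: "p \<in> S_carrier V \<Longrightarrow> q \<in> S_carrier V \<Longrightarrow> p + q \<in> S_carrier V"
  using keys_add[of p q] by (fastforce simp: S_carrier_eq)

lemma S_carrier_uminus: "p \<in> S_carrier V \<Longrightarrow> - p \<in> S_carrier V"
  by (auto simp: S_carrier_eq in_keys_iff)

lemma S_carrier_diff: "p \<in> S_carrier V \<Longrightarrow> q \<in> S_carrier V \<Longrightarrow> p - q \<in> S_carrier V"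
  using S_carrier_add[OF _ S_carrier_uminus, of p V q] by simp

lemma S_carrier_mult: "p \<in> S_carrier V \<Longrightarrow> q \<in> S_carrier V \<Longrightarrow> p * q \<in> S_carrier V"
  using keys_mult[of p q] by (force simp: S_carrier_eq intro: monomials_add)

lemmas S_carrier_closed =
  S_carrier_zero S_carrier_one S_carrier_add S_carrier_uminus S_carrier_diff S_carrier_mult

lemma cring_S_ring: "cring (S_ring V :: ('v, 'k::field) bpoly ring)"
proof (rule cringI)
  show "abelian_group (S_ring V :: ('v, 'k) bpoly ring)"
  proof (rule abelian_groupI)
    fix x :: "('v, 'k) bpoly"
    assume "x \<in> carrier (S_ring V)"
    then show "\<exists>y\<in>carrier (S_ring V). y \<oplus>\<^bsub>S_ring V\<^esub> x = \<zero>\<^bsub>S_ring V\<^esub>"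
      by (intro bexI[of _ "- x"]) (auto simp: S_carrier_closed)
  qed (auto simp: S_carrier_closed ac_simps)
  show "comm_monoid (S_ring V :: ('v, 'k) bpoly ring)"
    by (rule comm_monoidI) (auto simp: S_carrier_closed ac_simps)
qed (auto simp: distrib_right)

lemma subfield_S_scalars: "subfield (S_scalars :: ('v, 'k::field) bpoly set) (S_ring V)"
proof -
  interpret S: cring "S_ring V :: ('v, 'k) bpoly ring" by (rule cring_S_ring)
  let ?K = "S_scalars :: ('v, 'k) bpoly set"
  let ?F = "S_ring V \<lparr>carrier := ?K\<rparr>"
  have scalar: "Poly_Mapping.single 0 c \<in> ?K" for c by (auto simp: S_scalars_def)
  have one: "1 \<in> ?K" using scalar[of 1] by simp
  have zero: "0 \<in> ?K" using scalar[of 0] by simp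
  have closed: "x + y \<in> ?K" "x * y \<in> ?K" "- x \<in> ?K" if "x \<in> ?K" "y \<in> ?K" for x y
    using that by (auto simp: S_scalars_def mult_single simp flip: single_add single_uminus)
  have "?K \<subseteq> S_carrier V"
    by (auto simp: S_scalars_def intro!: single_in_S_carrier) (simp add: monomials_def)
  moreover have "field ?F"
  proof (rule cring.cring_fieldI2)
    show "cring ?F"
    proof (rule cringI)
      show "abelian_group ?F"
      proof (rule abelian_groupI)
        fix x assume "x \<in> carrier ?F"
        then show "\<exists>y\<in>carrier ?F. y \<oplus>\<^bsub>?F\<^esub> x = \<zero>\<^bsub>?F\<^esub>"
          by (intro bexI[of _ "- x"]) (auto simp: closed)
      qed (auto simp: closed zero ac_simps)
      show "comm_monoid ?F" by (rule comm_monoidI) (auto simp: closed one ac_simps)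
    qed (auto simp: distrib_right)
    show "\<zero>\<^bsub>?F\<^esub> \<noteq> \<one>\<^bsub>?F\<^esub>" by simp
    fix a assume "a \<in> carrier ?F" "a \<noteq> \<zero>\<^bsub>?F\<^esub>"
    then obtain c where "a = Poly_Mapping.single 0 c" "c \<noteq> 0" by (fastforce simp: S_scalars_def)
    then show "\<exists>b\<in>carrier ?F. a \<otimes>\<^bsub>?F\<^esub> b = \<one>\<^bsub>?F\<^esub>"
      by (intro bexI[of _ "Poly_Mapping.single 0 (inverse c)"]) (auto simp: mult_single scalar)
  qed
  ultimately show ?thesis using S.subfield_iff(1) by simp
qed

lemma poly_eq_sum_terms:
  "p = (\<Sum>m\<in>Poly_Mapping.keys p. Poly_Mapping.single m (Poly_Mapping.lookup p m))"
  by (rule poly_mapping_eqI)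
    (auto simp: lookup_sum lookup_single when_def in_keys_iff sum.delta')

text \<open>
  The linear span of the swap differences. This description of $J_G$ uses only scalar
  coefficients, so that linear functionals can be evaluated on it term by term.
\<close>
inductive_set swap_ideal :: "'v set \<Rightarrow> 'v set set \<Rightarrow> ('v, 'k::field) bpoly set" for V E where
  zero: "0 \<in> swap_ideal V E"
| add: "p \<in> swap_ideal V E \<Longrightarrow> m \<in> monomials V \<Longrightarrow> swap E m m' \<Longrightarrow>
    p + (Poly_Mapping.single m c - Poly_Mapping.single m' c) \<in> swap_ideal V E"

lemma swap_difference_in_swap_ideal:
  assumes "m \<in> monomials V" "swap E m m'"
  shows "Poly_Mapping.single m c - Poly_Mapping.single m' c \<in> swap_ideal V E"
  using swap_ideal.add[OF swap_ideal.zero assms, of c] by simp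

lemma swap_ideal_add:
  assumes "p \<in> swap_ideal V E" "q \<in> swap_ideal V E"
  shows "p + q \<in> swap_ideal V E"
  using assms(2)
proof induction
  case zero
  with assms(1) show ?case by simp
next
  case (add q m m' c)
  from swap_ideal.add[OF add.IH add.hyps(2,3), of c] show ?case by (simp add: add.assoc)
qed

lemma swap_ideal_uminus: "p \<in> swap_ideal V E \<Longrightarrow> - p \<in> swap_ideal V E"
proof (induction rule: swap_ideal.induct)
  case (add p m m' c)
  from swap_ideal.add[OF add.IH add.hyps(2,3), of "- c"] show ?case
    by (simp add: single_uminus algebra_simps)
qed (simp add: swap_ideal.zero)

lemma swap_ideal_sum:
  "(\<And>i. i \<in> I \<Longrightarrow> f i \<in> swap_ideal V E) \<Longrightarrow> sum f I \<in> swap_ideal V E"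
  by (induction I rule: infinite_finite_induct) (auto intro: swap_ideal.zero swap_ideal_add)

lemma swap_ideal_single_mult:
  assumes "p \<in> swap_ideal V E" "l \<in> monomials V"
  shows "Poly_Mapping.single l k * p \<in> swap_ideal V E"
  using assms(1)
proof induction
  case (add p m m' c)
  have "Poly_Mapping.single (l + m) (k * c) - Poly_Mapping.single (l + m') (k * c) \<in> swap_ideal V E"
    using add.hyps assms(2) by (intro swap_difference_in_swap_ideal monomials_add swap_add_left)
  from swap_ideal_add[OF add.IH this] show ?case
    by (simp add: distrib_left right_diff_distrib mult_single)
qed (simp add: swap_ideal.zero)

lemma swap_ideal_mult:
  assumes "p \<in> swap_ideal V E" "q \<in> S_carrier V"
  shows "q * p \<in> swap_ideal V E"
proof -
  have "q * p = (\<Sum>m\<in>Poly_Mapping.keys q. Poly_Mapping.single m (Poly_Mapping.lookup q m) * p)"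
    by (subst poly_eq_sum_terms[of q]) (simp add: sum_distrib_right)
  also have "\<dots> \<in> swap_ideal V E"
    using assms by (intro swap_ideal_sum swap_ideal_single_mult) (auto simp: S_carrier_eq)
  finally show ?thesis .
qed

lemma swap_ideal_subset: "swap_ideal V E \<subseteq> S_carrier V"
proof
  fix p assume "p \<in> swap_ideal V E"
  then show "p \<in> S_carrier V"
  proof induction
    case (add p m m' c)
    then have "m' \<in> monomials V" by (simp add: monomials_iff_supp supp_swap)
    with add show ?case by (intro S_carrier_closed single_in_S_carrier)
  qed (rule S_carrier_closed)
qed

lemma S_ring_a_inv:
  assumes "x \<in> S_carrier V"
  shows "\<ominus>\<^bsub>S_ring V\<^esub> x = - x"
proof -
  interpret S: cring "S_ring V" by (rule cring_S_ring)
  show ?thesis using assms by (intro S.minus_equality) (auto simp: S_carrier_closed)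
qed

lemma ideal_swap_ideal: "ideal (swap_ideal V E :: ('v, 'k::field) bpoly set) (S_ring V)"
proof (rule idealI)
  interpret S: cring "S_ring V :: ('v, 'k) bpoly ring" by (rule cring_S_ring)
  show "ring (S_ring V :: ('v, 'k) bpoly ring)" by (rule S.ring_axioms)
  show "subgroup (swap_ideal V E :: ('v, 'k) bpoly set) (add_monoid (S_ring V))"
  proof (rule S.add.subgroupI)
    fix p :: "('v, 'k) bpoly" assume p: "p \<in> swap_ideal V E"
    then have "p \<in> S_carrier V" using swap_ideal_subset by blast
    with p show "\<ominus>\<^bsub>S_ring V\<^esub> p \<in> swap_ideal V E"
      by (simp add: S_ring_a_inv swap_ideal_uminus)
  next
    show "swap_ideal V E \<noteq> ({} :: ('v, 'k) bpoly set)" using swap_ideal.zero by blast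
  qed (use swap_ideal_subset in \<open>auto intro: swap_ideal_add\<close>)
  fix a x :: "('v, 'k) bpoly"
  assume "a \<in> swap_ideal V E" "x \<in> carrier (S_ring V)"
  then have "x * a \<in> swap_ideal V E" by (simp add: swap_ideal_mult)
  then show "x \<otimes>\<^bsub>S_ring V\<^esub> a \<in> swap_ideal V E" "a \<otimes>\<^bsub>S_ring V\<^esub> x \<in> swap_ideal V E"
    by (simp_all add: mult.commute)
qed

lemma binomial_generator_eq:
  "xpoly a * ypoly b - xpoly b * ypoly a =
    Poly_Mapping.single (xmon a + ymon b) 1 - Poly_Mapping.single (xmon b + ymon a) 1"
  by (simp add: xpoly_def ypoly_def xmon_def ymon_def mult_single)

text \<open>
  The span of the swap differences is closed under multiplication because swaps are stable under
  multiplication by a monomial, and it contains the generators; conversely each swap difference is a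
  monomial multiple of a generator.
\<close>
lemma binomial_edge_ideal_eq_swap_ideal:
  assumes "\<Union>E \<subseteq> V"
  shows "binomial_edge_ideal V E = (swap_ideal V E :: ('v, 'k::field) bpoly set)"
proof
  interpret S: cring "S_ring V :: ('v, 'k) bpoly ring" by (rule cring_S_ring)
  let ?G = "{xpoly a * ypoly b - xpoly b * ypoly a | a b. {a, b} \<in> E} :: ('v, 'k) bpoly set"
  have gen: "?G \<subseteq> swap_ideal V E"
  proof
    fix p assume "p \<in> ?G"
    then obtain a b where ab: "{a, b} \<in> E" and p: "p = xpoly a * ypoly b - xpoly b * ypoly a"
      by blast
    have "xmon a + ymon b \<in> monomials V"
      using ab assms by (auto simp: monomials_iff_supp supp_add)
    moreover have "swap E (xmon a + ymon b) (xmon b + ymon a)"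
      using swapI[OF ab, of 0] by simp
    ultimately show "p \<in> swap_ideal V E"
      unfolding p binomial_generator_eq by (rule swap_difference_in_swap_ideal)
  qed
  then show "binomial_edge_ideal V E \<subseteq> (swap_ideal V E :: ('v, 'k) bpoly set)"
    unfolding binomial_edge_ideal_def by (intro S.genideal_minimal ideal_swap_ideal)
  have G: "?G \<subseteq> carrier (S_ring V)" using gen swap_ideal_subset by force
  interpret J: ideal "binomial_edge_ideal V E :: ('v, 'k) bpoly set" "S_ring V"
    unfolding binomial_edge_ideal_def by (rule S.genideal_ideal[OF G])
  have in_J: "?G \<subseteq> binomial_edge_ideal V E"
    unfolding binomial_edge_ideal_def by (rule S.genideal_self[OF G])
  show "(swap_ideal V E :: ('v, 'k) bpoly set) \<subseteq> binomial_edge_ideal V E"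
  proof
    fix p :: "('v, 'k) bpoly" assume "p \<in> swap_ideal V E"
    then show "p \<in> binomial_edge_ideal V E"
    proof induction
      case zero
      show ?case using J.zero_closed by simp
    next
      case (add p m m' c)
      from add.hyps(3) show ?case
      proof cases
        case (swapI a b l)
        from add.hyps(2) have "l \<in> monomials V" by (simp add: swapI monomials_iff_supp supp_add)
        then have l: "Poly_Mapping.single l c \<in> S_carrier V" by (rule single_in_S_carrier)
        have "xpoly a * ypoly b - xpoly b * ypoly a \<in> (binomial_edge_ideal V E :: ('v, 'k) bpoly set)"
          using in_J swapI(3) by blast
        with l have "Poly_Mapping.single l c * (xpoly a * ypoly b - xpoly b * ypoly a)
            \<in> (binomial_edge_ideal V E :: ('v, 'k) bpoly set)"
          using J.I_l_closed by simp
        also have "Poly_Mapping.single l c * (xpoly a * ypoly b - xpoly b * ypoly a) =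
            Poly_Mapping.single m c - Poly_Mapping.single m' c"
          by (simp add: binomial_generator_eq right_diff_distrib mult_single swapI add.assoc)
        finally show ?thesis using add.IH J.a_closed by simp
      qed
    qed
  qed
qed

text \<open>
  For a set of monomials that no swap enters or leaves, this is a linear functional that vanishes on
  $J_G$; such functionals separate the swap classes in the quotient.
\<close>
definition coeff_sum :: "('v bvar \<Rightarrow>\<^sub>0 nat) set \<Rightarrow> ('v, 'k::field) bpoly \<Rightarrow> 'k" where
  "coeff_sum D p = (\<Sum>m\<in>D. Poly_Mapping.lookup p m)"

lemma coeff_sum_simps:
  "coeff_sum D 0 = 0"
  "coeff_sum D (p + q) = coeff_sum D p + coeff_sum D q"
  "coeff_sum D (p - q) = coeff_sum D p - coeff_sum D q"
  by (simp_all add: coeff_sum_def lookup_add lookup_minus sum.distrib sum_subtractf)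

lemma coeff_sum_single:
  "finite D \<Longrightarrow> coeff_sum D (Poly_Mapping.single m c) = (if m \<in> D then c else 0)"
  by (simp add: coeff_sum_def lookup_single when_def sum.delta)

lemma coeff_sum_swap_ideal:
  assumes "p \<in> swap_ideal V E" "finite D" "\<And>m m'. swap E m m' \<Longrightarrow> m' \<in> D \<longleftrightarrow> m \<in> D"
  shows "coeff_sum D p = 0"
  using assms(1)
proof induction
  case (add p m m' c)
  show ?case using add.IH assms(3)[OF add.hyps(3)]
    by (simp add: coeff_sum_simps coeff_sum_single[OF assms(2)])
qed (simp add: coeff_sum_simps)

definition swap_class ::
    "'v set \<Rightarrow> 'v set set \<Rightarrow> nat \<Rightarrow> ('v bvar \<Rightarrow>\<^sub>0 nat) \<Rightarrow> ('v bvar \<Rightarrow>\<^sub>0 nat) set" where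
  "swap_class V E d m = {m' \<in> monomials_of_degree V d. swap_type E m' = swap_type E m}"

lemma finite_swap_class: "finite V \<Longrightarrow> finite (swap_class V E d m)"
  by (simp add: swap_class_def finite_monomials_of_degree)

lemma coeff_sum_swap_class:
  assumes "finite V" "p \<in> swap_ideal V E"
  shows "coeff_sum (swap_class V E d m) p = 0"
proof (rule coeff_sum_swap_ideal[OF assms(2) finite_swap_class[OF assms(1)]])
  fix m1 m2 assume sw: "swap E m1 m2"
  show "m2 \<in> swap_class V E d m \<longleftrightarrow> m1 \<in> swap_class V E d m"
    unfolding swap_class_def mem_Collect_eq
      monomials_of_degree_swap[OF assms(1) sw] swap_type_swap[OF sw] ..
qed

text \<open>
  The quotient is not the zero ring, so the scalars remain a field in it.
\<close>
lemma one_notin_swap_ideal: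
  assumes "finite V"
  shows "(1 :: ('v, 'k::field) bpoly) \<notin> swap_ideal V E"
proof
  assume "(1 :: ('v, 'k) bpoly) \<in> swap_ideal V E"
  from coeff_sum_swap_class[OF assms this, of 0 0]
  have "coeff_sum (swap_class V E 0 0) (Poly_Mapping.single 0 1 :: ('v, 'k) bpoly) = 0" by simp
  moreover have "0 \<in> swap_class V E 0 0"
    by (simp add: swap_class_def monomials_of_degree_def monomials_def monomial_degree_def)
  ultimately show False by (simp add: coeff_sum_single[OF finite_swap_class[OF assms]] del: single_one)
qed

lemma swaps_difference_in_swap_ideal:
  assumes "(swap E)\<^sup>*\<^sup>* m m'" "m \<in> monomials V"
  shows "Poly_Mapping.single m c - Poly_Mapping.single m' c \<in> swap_ideal V E"
  using assms(1)
proof (induction rule: rtranclp_induct)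
  case base
  show ?case by (simp add: swap_ideal.zero)
next
  case (step y z)
  from step.hyps(1) have "supp y = supp m"
    by (induction rule: rtranclp_induct) (auto simp: supp_swap)
  then have "y \<in> monomials V" using assms(2) by (simp add: monomials_iff_supp)
  from swap_ideal_add[OF step.IH swap_difference_in_swap_ideal[OF this step.hyps(2)], of c]
  show ?case by simp
qed

section \<open>The Hilbert function counts swap types\<close>

text \<open>
  Linear independence of the images is required as a condition on the source ring, where the
  coefficients of a linear combination can be read off.
\<close>
lemma (in ring_hom_ring) dim_image:
  assumes K: "subfield K R" and one: "\<one>\<^bsub>S\<^esub> \<noteq> \<zero>\<^bsub>S\<^esub>" and Us: "set Us \<subseteq> carrier R"
    and indep: "\<And>Ks. set Ks \<subseteq> K \<Longrightarrow> h (R.combine Ks Us) = \<zero>\<^bsub>S\<^esub> \<Longrightarrow>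
      set (take (length Us) Ks) \<subseteq> {\<zero>}"
  shows "S.dim (h ` K) (h ` R.Span K Us) = length Us"
proof -
  have sub: "K \<subseteq> carrier R" using subfieldE(3)[OF K] .
  have hK: "subfield (h ` K) S" using img_is_subfield(2)[OF K one] .
  have "S.independent (h ` K) (map h Us)"
  proof (rule S.trivial_combine_imp_independent[OF hK])
    show "set (map h Us) \<subseteq> carrier S" using Us by auto
    fix Ks assume Ks: "set Ks \<subseteq> h ` K" and zero: "S.combine Ks (map h Us) = \<zero>\<^bsub>S\<^esub>"
    define Ls where "Ls = map (inv_into K h) Ks"
    have Ls: "set Ls \<subseteq> K" using Ks by (auto simp: Ls_def intro: inv_into_into)
    have "map h Ls = Ks" using Ks by (auto simp: Ls_def f_inv_into_f subset_iff intro: map_idI)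
    with zero combine_hom[of Ls Us] Ls sub Us have "h (R.combine Ls Us) = \<zero>\<^bsub>S\<^esub>" by auto
    from indep[OF Ls this] have "h ` set (take (length Us) Ls) \<subseteq> {\<zero>\<^bsub>S\<^esub>}" by auto
    then show "set (take (length (map h Us)) Ks) \<subseteq> {\<zero>\<^bsub>S\<^esub>}"
      using \<open>map h Ls = Ks\<close> by (metis length_map set_map take_map)
  qed
  from S.dimension_independent[OF this] have "S.dimension (length Us) (h ` K) (h ` R.Span K Us)"
    unfolding Span_hom[OF sub Us] length_map .
  from S.dimI[OF hK this] show ?thesis by (simp add: over_def)
qed

lemma combine_S_ring:
  fixes k u :: "('v, 'k::field) bpoly"
  shows "ring.combine (S_ring V) (k # Ks) (u # Us) = k * u + ring.combine (S_ring V) Ks Us"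
    and "ring.combine (S_ring V) Ks' [] = (0 :: ('v, 'k) bpoly)"
    and "ring.combine (S_ring V) [] Us' = (0 :: ('v, 'k) bpoly)"
proof -
  interpret S: cring "S_ring V :: ('v, 'k) bpoly ring" by (rule cring_S_ring)
  show "ring.combine (S_ring V) (k # Ks) (u # Us) = k * u + ring.combine (S_ring V) Ks Us"
    and "ring.combine (S_ring V) Ks' [] = (0 :: ('v, 'k) bpoly)"
    and "ring.combine (S_ring V) [] Us' = (0 :: ('v, 'k) bpoly)"
    by simp_all
qed

abbreviation term_list :: "('v bvar \<Rightarrow>\<^sub>0 nat) list \<Rightarrow> ('v, 'k::field) bpoly list" where
  "term_list \<equiv> map (\<lambda>m. Poly_Mapping.single m 1)"

lemma combine_terms_Cons:
  assumes "set (k # Ks) \<subseteq> S_scalars"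
  obtains c where "k = Poly_Mapping.single 0 c"
    "ring.combine (S_ring V) (k # Ks) (term_list (m # ms)) =
      Poly_Mapping.single m c + ring.combine (S_ring V) Ks (term_list ms)"
proof -
  from assms obtain c where "k = Poly_Mapping.single 0 c" by (auto simp: S_scalars_def)
  then show thesis by (intro that[of c]) (simp_all add: combine_S_ring mult_single)
qed

lemma coeff_sum_combine_disjoint:
  assumes "finite D" "set Ks \<subseteq> S_scalars" "D \<inter> set ms = {}"
  shows "coeff_sum D (ring.combine (S_ring V) Ks (term_list ms)) = 0"
  using assms(2,3)
proof (induction ms arbitrary: Ks)
  case Nil
  show ?case by (simp add: combine_S_ring coeff_sum_simps)
next
  case (Cons m ms)
  show ?case
  proof (cases Ks)
    case Nil
    then show ?thesis by (simp add: combine_S_ring coeff_sum_simps)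
  next
    case Ks: (Cons k Ks')
    obtain c where "ring.combine (S_ring V) (k # Ks') (term_list (m # ms)) =
        Poly_Mapping.single m c + ring.combine (S_ring V) Ks' (term_list ms)"
      using combine_terms_Cons Cons.prems(1) unfolding Ks by blast
    moreover have "coeff_sum D (ring.combine (S_ring V) Ks' (term_list ms)) = 0"
      using Cons.prems by (intro Cons.IH) (auto simp: Ks)
    ultimately show ?thesis
      using Cons.prems by (simp add: Ks coeff_sum_simps coeff_sum_single[OF assms(1)] del: list.map)
  qed
qed

text \<open>
  The sum of the coefficients over the swap class of the first monomial isolates its coefficient,
  because the remaining monomials lie in other classes.
\<close>
lemma combine_terms_independent:
  assumes V: "finite V" and "set Ks \<subseteq> S_scalars" "set ms \<subseteq> monomials_of_degree V d"
    "distinct (map (swap_type E) ms)"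
    "\<And>m. coeff_sum (swap_class V E d m) (ring.combine (S_ring V) Ks (term_list ms)) = 0"
  shows "set (take (length ms) Ks) \<subseteq> {0}"
  using assms(2-)
proof (induction ms arbitrary: Ks)
  case (Cons m ms)
  show ?case
  proof (cases Ks)
    case Ks: (Cons k Ks')
    let ?q = "ring.combine (S_ring V) Ks' (term_list ms)"
    obtain c where k: "k = Poly_Mapping.single 0 c"
      and comb: "ring.combine (S_ring V) (k # Ks') (term_list (m # ms)) = Poly_Mapping.single m c + ?q"
      using combine_terms_Cons Cons.prems(1) unfolding Ks by blast
    have sum: "(if m \<in> swap_class V E d l then c else 0) + coeff_sum (swap_class V E d l) ?q = 0" for l
      using Cons.prems(4)[of l] unfolding Ks comb
      by (simp add: coeff_sum_simps coeff_sum_single[OF finite_swap_class[OF V]])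
    have "swap_type E l \<noteq> swap_type E m" if "l \<in> set ms" for l
      using Cons.prems(3) that by (auto simp: image_iff)
    then have "swap_class V E d m \<inter> set ms = {}" by (auto simp: swap_class_def)
    then have "coeff_sum (swap_class V E d m) ?q = 0"
      using Cons.prems(1) by (intro coeff_sum_combine_disjoint finite_swap_class V) (auto simp: Ks)
    moreover have "m \<in> swap_class V E d m" using Cons.prems(2) by (simp add: swap_class_def)
    ultimately have c: "c = 0" using sum[of m] by simp
    have "set (take (length ms) Ks') \<subseteq> {0}"
      using Cons.prems sum c by (intro Cons.IH) (auto simp: Ks)
    with c k show ?thesis by (simp add: Ks)
  qed simp
qed simp

lemma combine_terms_homogeneous:
  assumes "set Ks \<subseteq> S_scalars" "set ms \<subseteq> monomials_of_degree V d"
  shows "ring.combine (S_ring V) Ks (term_list ms) \<in> S_homogeneous V d"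
  using assms
proof (induction ms arbitrary: Ks)
  case Nil
  show ?case by (simp add: combine_S_ring S_homogeneous_def S_carrier_zero)
next
  case (Cons m ms)
  show ?case
  proof (cases Ks)
    case Nil
    then show ?thesis by (simp add: combine_S_ring S_homogeneous_def S_carrier_zero)
  next
    case Ks: (Cons k Ks')
    let ?q = "ring.combine (S_ring V) Ks' (term_list ms)"
    obtain c where comb: "ring.combine (S_ring V) (k # Ks') (term_list (m # ms)) =
        Poly_Mapping.single m c + ?q"
      using combine_terms_Cons Cons.prems(1) unfolding Ks by blast
    have "?q \<in> S_homogeneous V d" using Cons.prems by (intro Cons.IH) (auto simp: Ks)
    then have "Poly_Mapping.keys ?q \<subseteq> monomials_of_degree V d"
      by (auto simp: S_homogeneous_def S_carrier_eq monomials_of_degree_def)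
    moreover have "Poly_Mapping.keys (Poly_Mapping.single m c) \<subseteq> monomials_of_degree V d"
      using Cons.prems(2) by simp
    ultimately have "Poly_Mapping.keys (Poly_Mapping.single m c + ?q) \<subseteq> monomials_of_degree V d"
      using keys_add[of "Poly_Mapping.single m c" ?q] by blast
    then show ?thesis unfolding Ks comb
      by (auto simp: S_homogeneous_def S_carrier_eq monomials_of_degree_def)
  qed
qed

text \<open>
  Modulo $J_G$ each term may be moved to the representative of its swap class; this is where the
  completeness of the swap type enters.
\<close>
lemma homogeneous_congruent_representatives:
  assumes p: "p \<in> S_homogeneous V d"
    and rep: "\<And>m. m \<in> monomials_of_degree V d \<Longrightarrow> swap_type E (rep m) = swap_type E m"
  shows "p - (\<Sum>m\<in>Poly_Mapping.keys p. Poly_Mapping.single (rep m) (Poly_Mapping.lookup p m))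
    \<in> swap_ideal V E" (is "p - ?q \<in> _")
proof -
  have "p - ?q = (\<Sum>m\<in>Poly_Mapping.keys p. Poly_Mapping.single m (Poly_Mapping.lookup p m)) - ?q"
    using poly_eq_sum_terms[of p] by simp
  also have "\<dots> = (\<Sum>m\<in>Poly_Mapping.keys p. Poly_Mapping.single m (Poly_Mapping.lookup p m) -
      Poly_Mapping.single (rep m) (Poly_Mapping.lookup p m))"
    by (rule sum_subtractf[symmetric])
  also have "\<dots> \<in> swap_ideal V E"
  proof (intro swap_ideal_sum swaps_difference_in_swap_ideal swaps_if_swap_type_eq)
    fix m assume "m \<in> Poly_Mapping.keys p"
    with p have m: "m \<in> monomials_of_degree V d"
      by (auto simp: S_homogeneous_def S_carrier_eq monomials_of_degree_def)
    then show "swap_type E m = swap_type E (rep m)" by (simp add: rep)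
    show "m \<in> monomials V" using m by (simp add: monomials_of_degree_def)
  qed
  finally show ?thesis .
qed

text \<open>
  A basis of the degree \<open>d\<close> part of the quotient is given by one monomial of each swap class.
\<close>
lemma dim_quotient_swap_ideal:
  assumes V: "finite V"
  shows "ring.dim (S_ring V Quot (swap_ideal V E :: ('v, 'k::field) bpoly set))
      (a_r_coset (S_ring V) (swap_ideal V E) ` S_scalars)
      (a_r_coset (S_ring V) (swap_ideal V E) ` S_homogeneous V d) =
    card (swap_type E ` monomials_of_degree V d)"
proof -
  define R where "R = (S_ring V :: ('v, 'k) bpoly ring)"
  define J where "J = (swap_ideal V E :: ('v, 'k) bpoly set)"
  let ?M = "monomials_of_degree V d"
  let ?K = "S_scalars :: ('v, 'k) bpoly set"
  let ?h = "a_r_coset R J"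
  interpret R: cring R unfolding R_def by (rule cring_S_ring)
  interpret J: ideal J R unfolding R_def J_def by (rule ideal_swap_ideal)
  interpret hom: ring_hom_ring R "R Quot J" ?h by (rule J.rcos_ring_hom_ring)
  have ops: "\<zero>\<^bsub>R\<^esub> = 0" "x \<oplus>\<^bsub>R\<^esub> y = x + y" "x \<otimes>\<^bsub>R\<^esub> y = x * y" for x y
    unfolding R_def S_ring_simps by (rule refl)+
  have K: "subfield ?K R" unfolding R_def by (rule subfield_S_scalars)
  have quot_zero: "\<zero>\<^bsub>R Quot J\<^esub> = J" by (simp only: FactRing_def ring.simps)
  have one: "\<one>\<^bsub>R Quot J\<^esub> \<noteq> \<zero>\<^bsub>R Quot J\<^esub>"
  proof
    assume "\<one>\<^bsub>R Quot J\<^esub> = \<zero>\<^bsub>R Quot J\<^esub>"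
    then have "?h \<one>\<^bsub>R\<^esub> = J" using hom.hom_one quot_zero by metis
    from J.rcos_const_imp_mem[OF R.one_closed this] have "1 \<in> J" unfolding R_def S_ring_simps .
    with one_notin_swap_ideal[OF V] show False unfolding J_def by blast
  qed
  \<comment> \<open>\<open>ms\<close> lists one monomial \<open>rep m\<close> for each swap type.\<close>
  have "finite (swap_type E ` ?M)" using finite_monomials_of_degree[OF V] by (rule finite_imageI)
  then obtain ts where ts: "set ts = swap_type E ` ?M" "distinct ts"
    using finite_distinct_list by blast
  define ms where "ms = map (inv_into ?M (swap_type E)) ts"
  define rep where "rep m = inv_into ?M (swap_type E) (swap_type E m)" for m
  have rep: "swap_type E (rep m) = swap_type E m" if "m \<in> ?M" for m
    unfolding rep_def by (rule f_inv_into_f[OF imageI[OF that]])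
  have rep_ms: "rep m \<in> set ms" if "m \<in> ?M" for m
    using that ts(1) unfolding ms_def rep_def set_map by blast
  have ms: "set ms \<subseteq> ?M"
    unfolding ms_def set_map ts(1) by (auto simp del: image_image intro: inv_into_into)
  have types: "map (swap_type E) ms = ts"
    unfolding ms_def map_map using ts(1) by (intro map_idI) (simp add: f_inv_into_f)
  have len: "length ms = card (swap_type E ` ?M)"
    using distinct_card[OF ts(2)] ts(1) by (simp add: ms_def)
  let ?Us = "term_list ms :: ('v, 'k) bpoly list"
  have Us: "set ?Us \<subseteq> carrier R"
    using ms unfolding R_def by (auto simp: monomials_of_degree_def intro!: single_in_S_carrier)
  have "ring.dim (R Quot J) (?h ` ?K) (?h ` R.Span ?K ?Us) = length ?Us"
  proof (rule hom.dim_image[OF K one Us])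
    fix Ks assume Ks: "set Ks \<subseteq> ?K" and zero: "?h (R.combine Ks ?Us) = \<zero>\<^bsub>R Quot J\<^esub>"
    have "R.combine Ks ?Us \<in> carrier R"
      using Ks subfieldE(3)[OF K] by (intro R.combine_in_carrier[OF _ Us]) (rule order.trans)
    from J.rcos_const_imp_mem[OF this zero[unfolded quot_zero]] have mem: "R.combine Ks ?Us \<in> J" .
    have "set (take (length ms) Ks) \<subseteq> {0}"
    proof (rule combine_terms_independent[OF V Ks ms])
      show "distinct (map (swap_type E) ms)" using ts(2) types by simp
      show "coeff_sum (swap_class V E d m) (ring.combine (S_ring V) Ks ?Us) = 0" for m
        using mem unfolding R_def J_def by (rule coeff_sum_swap_class[OF V])
    qed
    then show "set (take (length ?Us) Ks) \<subseteq> {\<zero>\<^bsub>R\<^esub>}" unfolding R_def by simp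
  qed
  moreover have "?h ` R.Span ?K ?Us = ?h ` S_homogeneous V d"
  proof
    have Span: "R.Span ?K ?Us \<subseteq> S_homogeneous V d"
      unfolding R.Span_eq_combine_set[OF K Us] using combine_terms_homogeneous[OF _ ms]
      unfolding R_def by blast
    then show "?h ` R.Span ?K ?Us \<subseteq> ?h ` S_homogeneous V d" by (rule image_mono)
    show "?h ` S_homogeneous V d \<subseteq> ?h ` R.Span ?K ?Us"
    proof (rule image_subsetI)
      fix p :: "('v, 'k) bpoly" assume p: "p \<in> S_homogeneous V d"
      define f where "f m = Poly_Mapping.single (rep m) (Poly_Mapping.lookup p m)" for m
      define q where "q = sum f (Poly_Mapping.keys p)"
      have f: "f m \<in> R.Span ?K ?Us" if "m \<in> Poly_Mapping.keys p" for m
      proof -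
        from that p have "m \<in> ?M"
          by (auto simp: S_homogeneous_def S_carrier_eq monomials_of_degree_def)
        then have "Poly_Mapping.single (rep m) 1 \<in> set ?Us" using rep_ms by simp
        then have base: "Poly_Mapping.single (rep m) 1 \<in> R.Span ?K ?Us"
          using R.Span_base_incl[OF K Us] by (rule rev_subsetD)
        have "Poly_Mapping.single 0 (Poly_Mapping.lookup p m) \<in> ?K" by (auto simp: S_scalars_def)
        from R.Span_smult_closed[OF K Us this base] show ?thesis
          unfolding ops f_def mult_single add_0_left mult_1_right .
      qed
      have "sum f I \<in> R.Span ?K ?Us" if "finite I" "I \<subseteq> Poly_Mapping.keys p" for I
        using that
      proof (induction I rule: finite_induct)
        case empty
        show ?case using R.Span_subgroup_props(2)[OF K Us] unfolding ops sum.empty .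
      next
        case (insert i I)
        then have "f i \<in> R.Span ?K ?Us" "sum f I \<in> R.Span ?K ?Us" using f by blast+
        from R.Span_subgroup_props(3)[OF K Us this] show ?case
          unfolding ops sum.insert[OF insert.hyps] .
      qed
      from this[OF finite_keys order.refl] have q: "q \<in> R.Span ?K ?Us" unfolding q_def .
      have "p - q \<in> J"
        unfolding q_def f_def J_def by (rule homogeneous_congruent_representatives[OF p rep])
      have qR: "q \<in> carrier R" using q R.Span_subgroup_props(1)[OF K Us] by (rule rev_subsetD)
      have "(p - q) \<oplus>\<^bsub>R\<^esub> q \<in> ?h q"
        using \<open>p - q \<in> J\<close> J.a_subset qR by (rule R.a_rcosI)
      then have "p \<in> ?h q" unfolding ops diff_add_cancel .
      from J.a_repr_independence'[OF this qR, symmetric] q show "?h p \<in> ?h ` R.Span ?K ?Us"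
        by (rule image_eqI)
    qed
  qed
  ultimately show ?thesis unfolding R_def J_def by (simp only: length_map len[symmetric])
qed

section \<open>Counting swap types\<close>

text \<open>
  The possible multidegrees with support \<open>U\<close> and total degree \<open>d\<close>.
\<close>
definition positive_functions :: "'v set \<Rightarrow> nat \<Rightarrow> ('v \<Rightarrow> nat) set" where
  "positive_functions U d = {a \<in> U \<rightarrow>\<^sub>E {1..}. sum a U = d}"

lemma finite_positive_functions:
  assumes "finite U"
  shows "finite (positive_functions U d)"
proof (rule finite_subset)
  show "positive_functions U d \<subseteq> U \<rightarrow>\<^sub>E {..d}"
    using assms by (auto simp: positive_functions_def PiE_iff extensional_def intro: member_le_sum)
  show "finite (U \<rightarrow>\<^sub>E {..d})" using assms by (simp add: finite_PiE)
qed

lemma bounded_function_with_sum: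
  fixes a :: "'v \<Rightarrow> nat"
  assumes "finite C" "r \<le> sum a C"
  obtains k where "\<And>v. k v \<le> a v" "sum k C = r"
proof -
  from assms have "\<exists>k. (\<forall>v. k v \<le> a v) \<and> sum k C = r"
  proof (induction C arbitrary: r rule: finite_induct)
    case empty
    then show ?case by (intro exI[of _ "\<lambda>_. 0"]) simp
  next
    case (insert v C)
    then have "r - min r (a v) \<le> sum a C" by simp
    from insert.IH[OF this] obtain k where k: "\<forall>w. k w \<le> a w" "sum k C = r - min r (a v)"
      by blast
    have "sum (k(v := min r (a v))) C = sum k C"
      using insert.hyps by (intro sum.cong) auto
    with k insert.hyps show ?case by (intro exI[of _ "k(v := min r (a v))"]) auto
  qed
  with that show thesis by blast
qed

lemma monomial_with_degrees:
  assumes "finite U"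
  shows "\<exists>m. (\<forall>v. xdeg m v = (if v \<in> U then k v else 0)) \<and>
    (\<forall>v. ydeg m v = (if v \<in> U then l v else 0))"
proof -
  define f where "f z = (case z of xvar v \<Rightarrow> if v \<in> U then k v else 0 | yvar v \<Rightarrow> if v \<in> U then l v else 0)" for z
  have "{z. f z \<noteq> 0} \<subseteq> xvar ` U \<union> yvar ` U"
  proof
    fix z assume "z \<in> {z. f z \<noteq> 0}"
    then show "z \<in> xvar ` U \<union> yvar ` U" by (cases z) (auto simp: f_def split: if_splits)
  qed
  then have "finite {z. f z \<noteq> 0}" using assms by (auto intro: finite_subset)
  then have "Poly_Mapping.lookup (Abs_poly_mapping f) = f" by simp
  then show ?thesis
    by (intro exI[of _ "Abs_poly_mapping f"]) (simp_all add: xdeg_def ydeg_def f_def)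
qed

text \<open>
  Every conceivable triple occurs: given the multidegree \<open>a\<close> and for each component \<open>C\<close> a number
  $r_C$ between $0$ and the degree of \<open>a\<close> on \<open>C\<close>, choose on each component \<open>x\<close>-degrees of at most \<open>a\<close>
  with sum $r_C$ and fill up with \<open>y\<close>-variables.
\<close>
lemma swap_type_image:
  assumes V: "finite V"
  shows "swap_type E ` monomials_of_degree V d =
    (SIGMA U:Pow V. SIGMA a:positive_functions U d. PiE (comps E U) (\<lambda>C. {..sum a C}))"
    (is "_ = ?T")
proof
  show "swap_type E ` monomials_of_degree V d \<subseteq> ?T"
  proof (rule image_subsetI)
    fix m assume m: "m \<in> monomials_of_degree V d"
    let ?U = "supp m" and ?a = "restrict (vdeg m) (supp m)"
    have U: "?U \<subseteq> V" using m by (simp add: monomials_of_degree_def monomials_iff_supp)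
    have "sum ?a ?U = monomial_degree m"
      by (subst monomial_degree_eq_sum_vdeg[of ?U]) (auto simp: monomials_iff_supp intro: sum.cong)
    moreover have "?a \<in> ?U \<rightarrow>\<^sub>E {1..}" by (auto simp: supp_def)
    ultimately have a: "?a \<in> positive_functions ?U d"
      using m by (simp add: positive_functions_def monomials_of_degree_def)
    have "(\<Sum>v\<in>C. xdeg m v) \<le> sum ?a C" if "C \<in> comps E ?U" for C
      using comps_subset[OF that] by (intro sum_mono) (auto simp: vdeg_def)
    then have "restrict (\<lambda>C. \<Sum>v\<in>C. xdeg m v) (comps E ?U) \<in> PiE (comps E ?U) (\<lambda>C. {..sum ?a C})"
      by auto
    with U a show "swap_type E m \<in> ?T" unfolding swap_type_def by blast
  qed
  show "?T \<subseteq> swap_type E ` monomials_of_degree V d"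
  proof
    fix t assume "t \<in> ?T"
    then obtain U a r where t: "t = (U, a, r)" and U: "U \<subseteq> V" and a: "a \<in> positive_functions U d"
      and r: "r \<in> PiE (comps E U) (\<lambda>C. {..sum a C})"
      by auto
    have finU: "finite U" using U V by (rule finite_subset)
    have ex: "\<exists>k. (\<forall>v. k v \<le> a v) \<and> sum k C = r C" if C: "C \<in> comps E U" for C
    proof -
      have "r C \<le> sum a C" using PiE_mem[OF r C] by simp
      with bounded_function_with_sum[OF finite_subset[OF comps_subset[OF C] finU], of "r C" a]
      show ?thesis by blast
    qed
    define K where "K C = (SOME k. (\<forall>v. k v \<le> a v) \<and> sum k C = r C)" for C
    have K: "K C v \<le> a v" "sum (K C) C = r C" if "C \<in> comps E U" for C v
      using someI_ex[OF ex[OF that]] unfolding K_def by blast+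
    define comp where "comp v = (THE C. C \<in> comps E U \<and> v \<in> C)" for v
    have comp: "comp v = C" if "C \<in> comps E U" "v \<in> C" for C v
      unfolding comp_def using that comps_disjoint[OF that(1)] by (intro the_equality) blast+
    have comp_in: "comp v \<in> comps E U" if v: "v \<in> U" for v
    proof -
      obtain C where "C \<in> comps E U" "v \<in> C" using v Union_comps[of U E] by blast
      with comp show ?thesis by simp
    qed
    obtain m where m: "\<And>v. xdeg m v = (if v \<in> U then K (comp v) v else 0)"
      "\<And>v. ydeg m v = (if v \<in> U then a v - K (comp v) v else 0)"
      using monomial_with_degrees[OF finU, of "\<lambda>v. K (comp v) v" "\<lambda>v. a v - K (comp v) v"]
      by blast
    have vdeg: "vdeg m v = (if v \<in> U then a v else 0)" for v
      using K(1)[OF comp_in] by (simp add: vdeg_def m)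
    have a_ext: "a \<in> U \<rightarrow>\<^sub>E {1..}" and a_sum: "sum a U = d"
      using a by (simp_all add: positive_functions_def)
    have supp: "supp m = U" using a_ext by (force simp: supp_def vdeg)
    have "monomial_degree m = d"
      using monomial_degree_eq_sum_vdeg[OF finU, of m] a_sum by (simp add: monomials_iff_supp supp vdeg)
    then have "m \<in> monomials_of_degree V d"
      using U by (simp add: monomials_of_degree_def monomials_iff_supp supp)
    moreover have "restrict (vdeg m) U = a"
      using a_ext by (auto simp: vdeg fun_eq_iff PiE_iff extensional_def)
    moreover have "restrict (\<lambda>C. \<Sum>v\<in>C. xdeg m v) (comps E U) = r"
    proof
      fix C
      show "restrict (\<lambda>C. \<Sum>v\<in>C. xdeg m v) (comps E U) C = r C"
      proof (cases "C \<in> comps E U")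
        case True
        have "(\<Sum>v\<in>C. xdeg m v) = sum (K C) C"
          using comps_subset[OF True] comp[OF True] by (intro sum.cong) (auto simp: m)
        with True K(2) show ?thesis by simp
      next
        case False
        with r show ?thesis by (simp add: PiE_iff extensional_def)
      qed
    qed
    ultimately have "swap_type E m = t" by (simp add: swap_type_def supp t)
    with \<open>m \<in> monomials_of_degree V d\<close> show "t \<in> swap_type E ` monomials_of_degree V d" by blast
  qed
qed

lemma card_swap_types:
  assumes V: "finite V"
  shows "card (swap_type E ` monomials_of_degree V d) =
    (\<Sum>U\<in>Pow V. \<Sum>a\<in>positive_functions U d. \<Prod>C\<in>comps E U. sum a C + 1)"
proof -
  have fin: "finite U" if "U \<in> Pow V" for U using that V by (auto intro: finite_subset)
  have fin_PiE: "finite (PiE (comps E U) (\<lambda>C. {..sum a C}))" if "U \<in> Pow V" for U and a :: "'a \<Rightarrow> nat"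
    using fin[OF that] by (intro finite_PiE finite_comps) auto
  have "card (swap_type E ` monomials_of_degree V d) =
      (\<Sum>U\<in>Pow V. card (SIGMA a:positive_functions U d. PiE (comps E U) (\<lambda>C. {..sum a C})))"
    unfolding swap_type_image[OF V] using V
    by (intro card_SigmaI) (auto intro!: finite_SigmaI finite_positive_functions fin fin_PiE)
  also have "\<dots> = (\<Sum>U\<in>Pow V. \<Sum>a\<in>positive_functions U d. card (PiE (comps E U) (\<lambda>C. {..sum a C})))"
    by (intro sum.cong refl card_SigmaI) (auto intro!: finite_positive_functions fin fin_PiE)
  also have "\<dots> = (\<Sum>U\<in>Pow V. \<Sum>a\<in>positive_functions U d. \<Prod>C\<in>comps E U. sum a C + 1)"
    by (intro sum.cong refl) (simp add: card_PiE finite_comps fin)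
  finally show ?thesis .
qed

section \<open>Generating functions\<close>

text \<open>
  This is $\sum_a w(a) t^{|a|}$ over the multidegrees \<open>a\<close> with support \<open>U\<close>.
\<close>
definition weight_series :: "'v set \<Rightarrow> (('v \<Rightarrow> nat) \<Rightarrow> rat) \<Rightarrow> rat fps" where
  "weight_series U w = Abs_fps (\<lambda>d. \<Sum>a\<in>positive_functions U d. w a)"

lemma weight_series_empty: "weight_series ({} :: 'v set) w = fps_const (w (\<lambda>_. undefined))"
proof (rule fps_ext)
  fix d
  have "positive_functions ({} :: 'v set) d = (if d = 0 then {\<lambda>_. undefined} else {})"
    by (auto simp: positive_functions_def)
  then show "fps_nth (weight_series {} w) d = fps_nth (fps_const (w (\<lambda>_. undefined))) d"
    by (cases "d = 0") (simp_all add: weight_series_def)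
qed

text \<open>
  Multiplicativity: a multidegree on a disjoint union is a pair of multidegrees on the parts.
\<close>
lemma weight_series_Un:
  assumes fin: "finite A" "finite B" and disj: "A \<inter> B = {}"
    and w: "\<And>d a. a \<in> positive_functions (A \<union> B) d \<Longrightarrow> w a = u (restrict a A) * v (restrict a B)"
  shows "weight_series (A \<union> B) w = weight_series A u * weight_series B v"
proof (rule fps_ext)
  fix d
  let ?I = "SIGMA i:{0..d}. positive_functions A i \<times> positive_functions B (d - i)"
  have "fps_nth (weight_series A u * weight_series B v) d =
      (\<Sum>i=0..d. (\<Sum>a\<in>positive_functions A i. u a) * (\<Sum>b\<in>positive_functions B (d - i). v b))"
    by (simp add: fps_mult_nth weight_series_def)
  also have "\<dots> = (\<Sum>i=0..d. \<Sum>(a, b)\<in>positive_functions A i \<times> positive_functions B (d - i). u a * v b)"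
    by (simp add: sum_product sum.cartesian_product)
  also have "\<dots> = (\<Sum>(i, a, b)\<in>?I. u a * v b)"
    using fin by (subst sum.Sigma) (auto intro: finite_positive_functions)
  also have "\<dots> = (\<Sum>a\<in>positive_functions (A \<union> B) d. w a)"
  proof (rule sum.reindex_bij_witness[symmetric, where j = "\<lambda>a. (sum a A, restrict a A, restrict a B)"
        and i = "\<lambda>(i, a, b) x. if x \<in> A then a x else b x"])
    fix a assume a: "a \<in> positive_functions (A \<union> B) d"
    have s: "sum a A + sum a B = d"
      using a sum.union_disjoint[OF fin disj, of a] by (simp add: positive_functions_def)
    show "(case (sum a A, restrict a A, restrict a B) of (i, a, b) \<Rightarrow> \<lambda>x. if x \<in> A then a x else b x) = a"
      using a by (auto simp: positive_functions_def PiE_iff extensional_def fun_eq_iff)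
    show "(sum a A, restrict a A, restrict a B) \<in> ?I"
      using a s by (auto simp: positive_functions_def PiE_iff)
    show "(case (sum a A, restrict a A, restrict a B) of (i, a, b) \<Rightarrow> u a * v b) = w a"
      using w[OF a] by simp
  next
    fix t assume "t \<in> ?I"
    then obtain i a b where t: "t = (i, a, b)" and i: "i \<le> d"
      and a: "a \<in> positive_functions A i" and b: "b \<in> positive_functions B (d - i)"
      by auto
    let ?c = "\<lambda>x. if x \<in> A then a x else b x"
    have sA: "sum ?c A = i" using a by (simp add: positive_functions_def)
    have "sum ?c B = sum b B" using disj by (intro sum.cong) auto
    then have sB: "sum ?c B = d - i" using b by (simp add: positive_functions_def)
    have rA: "restrict ?c A = a"
      using a by (auto simp: positive_functions_def PiE_iff extensional_def fun_eq_iff)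
    have rB: "restrict ?c B = b"
      using b disj by (auto simp: positive_functions_def PiE_iff extensional_def fun_eq_iff)
    have "?c \<in> A \<union> B \<rightarrow>\<^sub>E {1..}"
      using a b by (auto simp: positive_functions_def PiE_iff extensional_def)
    then show "(case t of (i, a, b) \<Rightarrow> \<lambda>x. if x \<in> A then a x else b x) \<in> positive_functions (A \<union> B) d"
      using sA sB i sum.union_disjoint[OF fin disj, of ?c] by (simp add: t positive_functions_def)
    show "(sum (case t of (i, a, b) \<Rightarrow> \<lambda>x. if x \<in> A then a x else b x) A,
        restrict (case t of (i, a, b) \<Rightarrow> \<lambda>x. if x \<in> A then a x else b x) A,
        restrict (case t of (i, a, b) \<Rightarrow> \<lambda>x. if x \<in> A then a x else b x) B) = t"
      using sA rA rB by (simp add: t)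
  qed
  finally show "fps_nth (weight_series (A \<union> B) w) d = fps_nth (weight_series A u * weight_series B v) d"
    by (simp add: weight_series_def)
qed

lemma weight_series_singleton: "weight_series {v} (\<lambda>_. 1) = fps_X * inverse (1 - fps_X)"
proof (rule fps_ext)
  fix d
  have "positive_functions {v} d = (if d = 0 then {} else {restrict (\<lambda>_. d) {v}})"
    by (auto simp: positive_functions_def PiE_iff extensional_def fun_eq_iff)
  then have "fps_nth (weight_series {v} (\<lambda>_. 1)) d = (if d = 0 then 0 else 1)"
    by (simp add: weight_series_def)
  then show "fps_nth (weight_series {v} (\<lambda>_. 1)) d = fps_nth (fps_X * inverse (1 - fps_X)) d"
    by (simp add: fps_inverse_one_minus_fps_X)
qed

lemma weight_series_one:
  "finite U \<Longrightarrow> weight_series U (\<lambda>_. 1) = (fps_X * inverse (1 - fps_X)) ^ card U"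
proof (induction U rule: finite_induct)
  case empty
  show ?case by (simp add: weight_series_empty)
next
  case (insert v U)
  have "weight_series ({v} \<union> U) (\<lambda>_. 1) = weight_series {v} (\<lambda>_. 1) * weight_series U (\<lambda>_. 1)"
    using insert.hyps by (intro weight_series_Un) auto
  with insert show ?case by (simp add: weight_series_singleton)
qed

text \<open>
  The weight depends only on the total degree, and $\sum_d (d+1) N_d t^d = N + t N'$. Here
  $N = \sum_d N_d t^d = (t/(1-t))^{|C|}$ counts the positive multidegrees on \<open>C\<close>, and $(t/(1-t))' = 1/(1-t)^2$.
\<close>
lemma weight_series_component:
  assumes "finite C"
  shows "weight_series C (\<lambda>a. of_nat (sum a C + 1)) =
    fps_X ^ card C * inverse (1 - fps_X) ^ (card C + 1) * (of_nat (card C) + 1 - fps_X)"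
proof -
  define g :: "rat fps" where "g = inverse (1 - fps_X)"
  let ?N = "weight_series C (\<lambda>_. 1)"
  have g: "g * (1 - fps_X) = 1" unfolding g_def by (rule inverse_mult_eq_1) simp
  have deriv: "fps_deriv (fps_X * g) = g ^ 2"
  proof -
    have "fps_deriv g = g ^ 2"
      unfolding g_def by (subst fps_inverse_deriv) (simp_all add: power2_eq_square)
    then have "fps_deriv (fps_X * g) = g * (g * (1 - fps_X)) + fps_X * g ^ 2"
      by (simp add: g)
    then show ?thesis by (simp add: algebra_simps power2_eq_square)
  qed
  have "weight_series C (\<lambda>a. of_nat (sum a C + 1)) = ?N + fps_X * fps_deriv ?N"
  proof (rule fps_ext)
    fix d
    have "(\<Sum>a\<in>positive_functions C d. of_nat (sum a C + 1)) =
        (\<Sum>a\<in>positive_functions C d. of_nat (d + 1) :: rat)"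
      by (intro sum.cong) (auto simp: positive_functions_def)
    then show "fps_nth (weight_series C (\<lambda>a. of_nat (sum a C + 1))) d =
        fps_nth (?N + fps_X * fps_deriv ?N) d"
      by (cases d) (auto simp: weight_series_def algebra_simps)
  qed
  also have "?N = (fps_X * g) ^ card C" unfolding g_def by (rule weight_series_one[OF assms])
  also have "fps_X * fps_deriv ((fps_X * g) ^ card C) = of_nat (card C) * ((fps_X * g) ^ card C * g)"
    unfolding fps_deriv_power' deriv
    by (cases "card C") (simp_all add: power2_eq_square algebra_simps)
  also have "(fps_X * g) ^ card C + of_nat (card C) * ((fps_X * g) ^ card C * g) =
      (fps_X * g) ^ card C * (g * (1 - fps_X) + of_nat (card C) * g)"
    by (simp only: g) (simp add: algebra_simps)
  also have "\<dots> = fps_X ^ card C * g ^ (card C + 1) * (of_nat (card C) + 1 - fps_X)"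
    by (simp add: power_mult_distrib algebra_simps)
  finally show ?thesis unfolding g_def .
qed

lemma weight_series_disjoint_Union:
  fixes w :: "nat \<Rightarrow> rat"
  assumes "finite P" "\<And>C. C \<in> P \<Longrightarrow> finite C"
    and "\<And>C D. C \<in> P \<Longrightarrow> D \<in> P \<Longrightarrow> C \<noteq> D \<Longrightarrow> C \<inter> D = {}"
  shows "weight_series (\<Union>P) (\<lambda>a. \<Prod>C\<in>P. w (sum a C)) =
    (\<Prod>C\<in>P. weight_series C (\<lambda>a. w (sum a C)))"
  using assms
proof (induction P rule: finite_induct)
  case empty
  show ?case by (simp add: weight_series_empty)
next
  case (insert C P)
  have "weight_series (C \<union> \<Union>P) (\<lambda>a. \<Prod>D\<in>insert C P. w (sum a D)) =
      weight_series C (\<lambda>a. w (sum a C)) * weight_series (\<Union>P) (\<lambda>a. \<Prod>D\<in>P. w (sum a D))"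
  proof (rule weight_series_Un)
    show "finite C" "finite (\<Union>P)" using insert.prems insert.hyps by auto
    show "C \<inter> \<Union>P = {}" using insert.prems(2)[of C] insert.hyps by auto
    fix d and a :: "'a \<Rightarrow> nat"
    have "sum (restrict a (\<Union>P)) D = sum a D" if "D \<in> P" for D
      using that by (intro sum.cong) auto
    then show "(\<Prod>D\<in>insert C P. w (sum a D)) =
        w (sum (restrict a C) C) * (\<Prod>D\<in>P. w (sum (restrict a (\<Union>P)) D))"
      using insert.hyps by simp
  qed
  also have "weight_series (\<Union>P) (\<lambda>a. \<Prod>D\<in>P. w (sum a D)) = (\<Prod>D\<in>P. weight_series D (\<lambda>a. w (sum a D)))"
    using insert.prems by (intro insert.IH) auto
  finally show ?case using insert.hyps by simp
qed

lemma weight_series_components: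
  assumes "finite U"
  shows "weight_series U (\<lambda>a. \<Prod>C\<in>comps E U. of_nat (sum a C + 1)) =
    fps_X ^ card U * (\<Prod>C\<in>comps E U. of_nat (card C) + 1 - fps_X) /
      (1 - fps_X) ^ (card U + card (comps E U))"
proof -
  let ?P = "comps E U"
  have finC: "finite C" if "C \<in> ?P" for C
    using comps_subset[OF that] assms by (rule finite_subset)
  have card: "(\<Sum>C\<in>?P. card C) = card U"
    using card_Union_disjoint[of ?P] finC comps_disjoint[of _ U E] Union_comps[of U E]
    by (simp add: pairwise_def disjnt_def)
  have "weight_series U (\<lambda>a. \<Prod>C\<in>?P. of_nat (sum a C + 1)) =
      weight_series (\<Union>?P) (\<lambda>a. \<Prod>C\<in>?P. of_nat (sum a C + 1))"
    by (simp only: Union_comps)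
  also have "\<dots> = (\<Prod>C\<in>?P. weight_series C (\<lambda>a. of_nat (sum a C + 1)))"
    by (intro weight_series_disjoint_Union finite_comps assms finC comps_disjoint)
  also have "\<dots> = (\<Prod>C\<in>?P. fps_X ^ card C * inverse (1 - fps_X) ^ (card C + 1) *
      (of_nat (card C) + 1 - fps_X))"
    by (intro prod.cong refl weight_series_component finC)
  also have "\<dots> = fps_X ^ (\<Sum>C\<in>?P. card C) * inverse (1 - fps_X) ^ (\<Sum>C\<in>?P. card C + 1) *
      (\<Prod>C\<in>?P. of_nat (card C) + 1 - fps_X)"
    by (simp only: prod.distrib power_sum)
  also have "(\<Sum>C\<in>?P. card C + 1) = card U + card ?P" by (simp only: sum.distrib card) simp
  finally show ?thesis
    by (simp add: card fps_divide_unit fps_inverse_power mult_ac)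
qed

section \<open>The Hilbert series\<close>

theorem binomial_edge_hilbert_series_eq:
  fixes V :: "'v set"
  assumes V: "finite V" and E: "\<Union>E \<subseteq> V"
  shows "binomial_edge_hilbert_series TYPE('k::field) V E =
    (\<Sum>U\<in>Pow V. fps_X ^ card U * (\<Prod>C\<in>comps E U. of_nat (card C) + 1 - fps_X) /
      (1 - fps_X) ^ (card U + card (comps E U)))"
proof -
  have fin: "finite U" if "U \<in> Pow V" for U using that V by (auto intro: finite_subset)
  have "binomial_edge_hilbert_series TYPE('k) V E =
      Abs_fps (\<lambda>d. of_nat (card (swap_type E ` monomials_of_degree V d)))"
    unfolding binomial_edge_hilbert_series_def quotient_hilbert_series_def hilbert_series_def
      binomial_edge_ideal_eq_swap_ideal[OF E] dim_quotient_swap_ideal[OF V] ..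
  also have "\<dots> = (\<Sum>U\<in>Pow V. weight_series U (\<lambda>a. \<Prod>C\<in>comps E U. of_nat (sum a C + 1)))"
    by (rule fps_ext) (simp add: card_swap_types[OF V] fps_sum_nth weight_series_def)
  also have "\<dots> = (\<Sum>U\<in>Pow V. fps_X ^ card U * (\<Prod>C\<in>comps E U. of_nat (card C) + 1 - fps_X) /
      (1 - fps_X) ^ (card U + card (comps E U)))"
    by (intro sum.cong refl weight_series_components fin)
  finally show ?thesis .
qed

theorem proposition5p3:
  fixes n :: nat
  assumes "n \<ge> 5"
  shows "binomial_edge_hilbert_series TYPE('k::field) (G_verts n) (G_edges n) =
    (\<Sum>U \<in> Pow (G_verts n).
       let \<pi> = components U (induced_edges (G_edges n) U) in
       fps_X ^ card U * (\<Prod>C \<in> \<pi>. of_nat (card C) + 1 - fps_X)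
         / (1 - fps_X) ^ (card U + card \<pi>))"
proof -
  have "finite (G_verts n)" by (simp add: G_verts_def)
  moreover have "\<Union> (G_edges n) \<subseteq> G_verts n" by (auto simp: G_edges_def G_verts_def)
  ultimately show ?thesis unfolding Let_def by (rule binomial_edge_hilbert_series_eq)
qed

end
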